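(* Suppose that either (a) $\mu>0$, $\lambda\ge0$ and $-1<\alpha\le-\frac12$, or (b) $0<\mu\le1\le\lambda$ and $-1<\alpha\le0$. Then $$\int_0^x\left(x^\mu-t^\mu\right)^\lambda t^\alpha\cos t\,dt>0\qquad\text{for all } x>0.$$
   Context: All parameters are real. For $\lambda=0$ the factor $(x^\mu-t^\mu)^\lambda$ is $1$ for $0<t<x$.
   Formalization: The instances $\mu=\lambda=1$, $\alpha=0$, $x=2\pi k$ with $k\ge1$ are excluded, because there the integral equals $1-\cos x=0$ and the strict inequality fails; all other cases are unchanged. *)

theory Defs
  imports "HOL-Analysis.Analysis"
begin

text \<open>
  For \<open>\<mu> = \<lambda> = 1\<close> and \<open>\<alpha> = 0\<close> the integral
  \<open>\<integral>\<^sub>0\<^sup>x (x\<^sup>\<mu> - t\<^sup>\<mu>)\<^sup>\<lambda> t\<^sup>\<alpha> cos t dt\<close> equals \<open>1 - cos x\<close>, which vanishes at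
  every positive multiple of \<open>2\<pi>\<close>; strict positivity therefore fails at exactly these points.
\<close>

lemma corner_integral:
  fixes x :: real
  assumes "x > 0"
  shows "(LBINT t=0..x. (x powr 1 - t powr 1) powr 1 * t powr 0 * cos t) = 1 - cos x"
proof -
  have "(LBINT t=0..x. (x powr 1 - t powr 1) powr 1 * t powr 0 * cos t)
      = (LBINT t=0..x. (x - t) * cos t)"
    by (rule interval_integral_cong) (use assms in \<open>auto simp: einterval_def min_def max_def\<close>)
  also have "\<dots> = (LBINT t=ereal 0..ereal x. (x - t) * cos t)"
    by (simp add: zero_ereal_def)
  also have "\<dots> = ((x - x) * sin x - cos x) - ((x - 0) * sin 0 - cos 0)"
  proof (rule interval_integral_FTC_finite)
    show "continuous_on {min 0 x..max 0 x} (\<lambda>t. (x - t) * cos t)"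
      by (intro continuous_intros)
    show "((\<lambda>t. (x - t) * sin t - cos t) has_vector_derivative (x - t) * cos t)
        (at t within {min 0 x..max 0 x})" for t
      unfolding has_real_derivative_iff_has_vector_derivative[symmetric]
      by (auto intro!: derivative_eq_intros)
  qed
  finally show ?thesis by simp
qed

lemma corner_integral_eq_0_iff:
  fixes x :: real
  assumes "x > 0"
  shows "(LBINT t=0..x. (x powr 1 - t powr 1) powr 1 * t powr 0 * cos t) = 0
     \<longleftrightarrow> (\<exists>k::nat. x = 2 * pi * real k)"
proof -
  have "cos x = 1 \<longleftrightarrow> (\<exists>k::nat. x = 2 * pi * real k)"
    using assms cos_one_2pi[of x] by (auto simp: mult_ac mult_less_0_iff)
  with corner_integral[OF assms] show ?thesis by auto
qed

end

theory Submission
  imports Defs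
begin

text \<open>
  Let \<open>f\<close> be the weight \<open>(x powr \<mu> - t powr \<mu>) powr lam * t powr \<alpha>\<close> on \<open>(0, x)\<close>, extended by zero. It
  is nonnegative and decreasing on the positive half-line, and the integral in question is the integral of
  \<open>f t cos t\<close> over any \<open>(0, b)\<close> with \<open>b \<ge> x\<close>. Two elementary devices give its sign.
  
  Folding: on a period \<open>(c, c + 2 \<pi>)\<close> the integral of \<open>f t cos t\<close> equals that of
  \<open>(f t - f (t + \<pi>)) cos t\<close> over \<open>(c, c + \<pi>)\<close> (\<open>cos_integral_fold\<close>).
  
  Comparison: if \<open>H\<close> is decreasing and \<open>v\<close> changes sign once, from plus to minus at \<open>m\<close>, then the
  integral of \<open>H v\<close> is at least \<open>H m\<close> times the integral of \<open>v\<close>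
  (\<open>antimono_weight_integral_ge\<close>, with a strict version).
  
  For \<open>0 < \<mu> \<le> 1 \<le> lam\<close> and \<open>\<alpha> \<le> 0\<close> the weight is convex, so \<open>f t - f (t + \<pi>)\<close> is decreasing.
  Comparison with \<open>cos\<close>, whose integral over \<open>(2 \<pi> k, 2 \<pi> k + \<pi>)\<close> is zero, shows that no period
  contributes negatively, and that the first contributes positively once the convexity is strict
  (\<open>truncated_convex_cos_integral_pos\<close>). Strictness fails only for \<open>\<mu> = lam = 1\<close>, \<open>\<alpha> = 0\<close>, where
  the integral is \<open>1 - cos x\<close>.
  
  For \<open>\<alpha> \<le> -1/2\<close> the weight need not be convex, but it is \<open>t powr (-1/2)\<close> times a decreasing function
  \<open>H\<close>. On \<open>(0, 3 \<pi> / 2)\<close> comparison with \<open>t powr (-1/2) cos t\<close>, which changes sign only at \<open>\<pi> / 2\<close>,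
  reduces positivity to the numerical fact that this function has positive integral there
  (\<open>fresnel_first_lobes_pos\<close>). The periods starting at \<open>3 \<pi> / 2 + 2 \<pi> k\<close> begin with their positive lobe, so
  folding makes their contributions nonnegative for any decreasing \<open>f\<close>
  (\<open>antimono_fresnel_integral_pos\<close>).
\<close>

section \<open>Positivity of integrals from interior values\<close>

text \<open>
  Sign conditions are imposed in the open interval only: the weights below are singular at \<open>0\<close>, where
  \<open>powr\<close> takes the default value \<open>0\<close> and monotonicity breaks down.
\<close>
lemma integral_nonneg_interior:
  fixes g :: "real \<Rightarrow> real"
  assumes "g integrable_on {a..b}" and "\<And>t. a < t \<Longrightarrow> t < b \<Longrightarrow> 0 \<le> g t"
  shows "0 \<le> integral {a..b} g"
proof -
  have "g integrable_on {a<..<b}" and eq: "integral {a<..<b} g = integral {a..b} g"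
    using assms(1) by (auto simp: integrable_on_Icc_iff_Ioo integral_open_interval_real)
  then have "0 \<le> integral {a<..<b} g"
    by (intro integral_nonneg) (use assms(2) in auto)
  with eq show ?thesis by simp
qed

text \<open>
  The integrand is only assumed Henstock--Kurzweil integrable, possibly discontinuous or with an
  endpoint singularity. Being nonnegative, it is absolutely integrable, so a vanishing integral would
  make it zero almost everywhere, also on the interval where it is positive.
\<close>
lemma integral_pos_interior:
  fixes g :: "real \<Rightarrow> real"
  assumes g: "g integrable_on {a..b}" and nonneg: "\<And>t. a < t \<Longrightarrow> t < b \<Longrightarrow> 0 \<le> g t"
    and d: "a < d" "d \<le> b" and pos: "\<And>t. a < t \<Longrightarrow> t < d \<Longrightarrow> 0 < g t"
  shows "0 < integral {a..b} g"
proof -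
  have gO: "g integrable_on {a<..<b}" and eq: "integral {a<..<b} g = integral {a..b} g"
    using g by (auto simp: integrable_on_Icc_iff_Ioo integral_open_interval_real)
  have abs: "g absolutely_integrable_on {a<..<b}"
    using gO nonneg by (intro nonnegative_absolutely_integrable_1) auto
  have int: "integrable lebesgue (\<lambda>t. indicator {a<..<b} t *\<^sub>R g t)"
    using abs by (simp add: set_integrable_def)
  have val: "(LINT t|lebesgue. indicator {a<..<b} t *\<^sub>R g t) = integral {a..b} g"
    using set_lebesgue_integral_eq_integral(2)[OF abs] eq by (simp add: set_lebesgue_integral_def)
  have nn: "AE t in lebesgue. 0 \<le> indicator {a<..<b} t *\<^sub>R g t"
    using nonneg by (intro AE_I2) (auto simp: indicator_def)
  have "0 \<le> integral {a..b} g" by (rule integral_nonneg_interior[OF g nonneg])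
  moreover have "integral {a..b} g \<noteq> 0"
  proof
    assume "integral {a..b} g = 0"
    then have "AE t in lebesgue. indicator {a<..<b} t *\<^sub>R g t = 0"
      using integral_nonneg_eq_0_iff_AE[OF int nn] val by simp
    then have "AE t in lebesgue. t \<notin> {a<..<d}"
    proof eventually_elim
      case (elim t)
      then show ?case using pos[of t] d by (auto simp: indicator_def split: if_splits)
    qed
    then have "{a<..<d} \<in> null_sets lebesgue"
      by (subst AE_iff_null_sets) auto
    then have "emeasure lborel {a<..<d} = 0" by auto
    with d show False by simp
  qed
  ultimately show ?thesis by simp
qed

section \<open>Decreasing weights against a function changing sign once\<close>

lemma antimono_weight_integral_diff:
  fixes H v :: "real \<Rightarrow> real"
  assumes "v integrable_on {a..b}" and "(\<lambda>t. H t * v t) integrable_on {a..b}"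
  shows "(\<lambda>t. (H t - c) * v t) integrable_on {a..b}"
    and "integral {a..b} (\<lambda>t. (H t - c) * v t)
       = integral {a..b} (\<lambda>t. H t * v t) - c * integral {a..b} v"
proof -
  have cv: "(\<lambda>t. c * v t) integrable_on {a..b}"
    using assms(1) by (rule integrable_on_mult_right)
  show "(\<lambda>t. (H t - c) * v t) integrable_on {a..b}"
    using integrable_diff[OF assms(2) cv] by (simp add: algebra_simps)
  show "integral {a..b} (\<lambda>t. (H t - c) * v t)
       = integral {a..b} (\<lambda>t. H t * v t) - c * integral {a..b} v"
    using Henstock_Kurzweil_Integration.integral_diff[OF assms(2) cv] by (simp add: algebra_simps)
qed

text \<open>
  The key inequality. If \<open>v\<close> passes from nonnegative to nonpositive values at \<open>m\<close> and \<open>H\<close> is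
  decreasing, then \<open>H - H m\<close> changes sign at \<open>m\<close> in the same direction as \<open>v\<close>. Integrating the product
  bounds the integral of \<open>H v\<close> below by \<open>H m\<close> times the integral of \<open>v\<close>.
\<close>
lemma antimono_weight_nonneg:
  fixes H v :: "real \<Rightarrow> real"
  assumes m: "a < m" "m < b"
    and H: "\<And>s t. a < s \<Longrightarrow> s \<le> t \<Longrightarrow> t < b \<Longrightarrow> H t \<le> H s"
    and v: "\<And>t. a < t \<Longrightarrow> t \<le> m \<Longrightarrow> 0 \<le> v t" "\<And>t. m < t \<Longrightarrow> t < b \<Longrightarrow> v t \<le> 0"
    and t: "a < t" "t < b"
  shows "0 \<le> (H t - H m) * v t"
proof (cases "t \<le> m")
  case True
  then show ?thesis using H[of t m] v(1)[of t] m t by simp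
next
  case False
  then show ?thesis using H[of m t] v(2)[of t] m t by (intro mult_nonpos_nonpos) auto
qed

lemma antimono_weight_integral_ge:
  fixes H v :: "real \<Rightarrow> real"
  assumes m: "a < m" "m < b"
    and H: "\<And>s t. a < s \<Longrightarrow> s \<le> t \<Longrightarrow> t < b \<Longrightarrow> H t \<le> H s"
    and v: "\<And>t. a < t \<Longrightarrow> t \<le> m \<Longrightarrow> 0 \<le> v t" "\<And>t. m < t \<Longrightarrow> t < b \<Longrightarrow> v t \<le> 0"
    and int: "v integrable_on {a..b}" "(\<lambda>t. H t * v t) integrable_on {a..b}"
  shows "H m * integral {a..b} v \<le> integral {a..b} (\<lambda>t. H t * v t)"
proof -
  have "0 \<le> integral {a..b} (\<lambda>t. (H t - H m) * v t)"
  proof (rule integral_nonneg_interior[OF antimono_weight_integral_diff(1)[OF int]])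
    fix t assume "a < t" "t < b"
    then show "0 \<le> (H t - H m) * v t"
      by (rule antimono_weight_nonneg[OF m, rotated 3]) (auto intro: H v)
  qed
  then show ?thesis
    using antimono_weight_integral_diff(2)[OF int, of "H m"] by simp
qed

lemma antimono_weight_integral_gt:
  fixes H v :: "real \<Rightarrow> real"
  assumes m: "a < m" "m < b"
    and H: "\<And>s t. a < s \<Longrightarrow> s \<le> t \<Longrightarrow> t < b \<Longrightarrow> H t \<le> H s"
    and v: "\<And>t. a < t \<Longrightarrow> t \<le> m \<Longrightarrow> 0 \<le> v t" "\<And>t. m < t \<Longrightarrow> t < b \<Longrightarrow> v t \<le> 0"
    and int: "v integrable_on {a..b}" "(\<lambda>t. H t * v t) integrable_on {a..b}"
    and d: "a < d" "d \<le> b"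
    and strict: "\<And>t. a < t \<Longrightarrow> t < d \<Longrightarrow> H m < H t \<and> 0 < v t"
  shows "H m * integral {a..b} v < integral {a..b} (\<lambda>t. H t * v t)"
proof -
  have "0 < integral {a..b} (\<lambda>t. (H t - H m) * v t)"
  proof (rule integral_pos_interior[OF antimono_weight_integral_diff(1)[OF int] _ d])
    fix t assume "a < t" "t < b"
    then show "0 \<le> (H t - H m) * v t"
      by (rule antimono_weight_nonneg[OF m, rotated 3]) (auto intro: H v)
  next
    fix t assume "a < t" "t < d"
    then show "0 < (H t - H m) * v t" using strict[of t] by simp
  qed
  then show ?thesis
    using antimono_weight_integral_diff(2)[OF int, of "H m"] by simp
qed

section \<open>Reduction to single periods of the cosine\<close>

lemma integral_periods_nonneg:
  fixes q :: "real \<Rightarrow> real"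
  assumes p: "0 \<le> p" and q: "\<And>b. q integrable_on {a..b}"
    and per: "\<And>k::nat. 0 \<le> integral {a + real k * p..a + real k * p + p} q"
  shows "0 \<le> integral {a..a + real N * p} q"
proof (induction N)
  case 0
  then show ?case by simp
next
  case (Suc N)
  have "integral {a..a + real N * p} q + integral {a + real N * p..a + real (Suc N) * p} q
      = integral {a..a + real (Suc N) * p} q"
    using p q by (intro Henstock_Kurzweil_Integration.integral_combine) (auto simp: algebra_simps)
  moreover have eq: "a + real (Suc N) * p = a + real N * p + p" by (simp add: algebra_simps)
  ultimately show ?case using Suc.IH per[of N] unfolding eq by linarith
qed

text \<open>
  The second half of a period is moved onto the first by \<open>cos (t + \<pi>) = - cos t\<close>. The sign of the
  integral is thus governed by the differences \<open>f t - f (t + \<pi>)\<close>: they are nonnegative if \<open>f\<close>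
  decreases, and decreasing if \<open>f\<close> is convex.
\<close>
lemma cos_integral_fold:
  fixes f :: "real \<Rightarrow> real"
  assumes "(\<lambda>t. f t * cos t) integrable_on {a..a + 2 * pi}"
  shows "(\<lambda>t. (f t - f (t + pi)) * cos t) integrable_on {a..a + pi}"
    and "integral {a..a + 2 * pi} (\<lambda>t. f t * cos t)
       = integral {a..a + pi} (\<lambda>t. (f t - f (t + pi)) * cos t)"
proof -
  let ?q = "\<lambda>t. f t * cos t"
  have 1: "?q integrable_on {a..a + pi}"
    by (rule integrable_subinterval_real[OF assms]) auto
  have "?q integrable_on {a + pi..a + pi + pi}"
    by (rule integrable_subinterval_real[OF assms]) auto
  then have 2: "(?q \<circ> (+) pi) integrable_on {a..a + pi}"
    by (simp only: integrable_on_shift_Icc_real)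
  have eq: "(?q \<circ> (+) pi) = (\<lambda>t. - (f (t + pi) * cos t))"
    by (simp add: fun_eq_iff add.commute)
  have sum: "(\<lambda>t. ?q t + (?q \<circ> (+) pi) t) = (\<lambda>t. (f t - f (t + pi)) * cos t)"
    by (simp add: eq algebra_simps)
  show "(\<lambda>t. (f t - f (t + pi)) * cos t) integrable_on {a..a + pi}"
    using integrable_add[OF 1 2] by (simp only: sum)
  have "integral {a..a + 2 * pi} ?q = integral {a..a + pi} ?q + integral {a + pi..a + pi + pi} ?q"
    using Henstock_Kurzweil_Integration.integral_combine[OF _ _ assms, of "a + pi"]
    by (simp add: add.assoc)
  also have "integral {a + pi..a + pi + pi} ?q = integral {a..a + pi} (?q \<circ> (+) pi)"
    by (simp only: integral_shift_Icc_real)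
  also have "integral {a..a + pi} ?q + \<dots> = integral {a..a + pi} (\<lambda>t. (f t - f (t + pi)) * cos t)"
    using Henstock_Kurzweil_Integration.integral_add[OF 1 2] by (simp only: sum)
  finally show "integral {a..a + 2 * pi} ?q
       = integral {a..a + pi} (\<lambda>t. (f t - f (t + pi)) * cos t)" .
qed

section \<open>The Fresnel-type integral over the first two lobes\<close>

lemma cos_bound_below: "1 - t\<^sup>2 / 2 \<le> cos (t::real)"
proof -
  have "\<bar>sin (t / 2)\<bar> \<le> \<bar>t / 2\<bar>" by (rule abs_sin_x_le_abs_x)
  then have "(sin (t / 2))\<^sup>2 \<le> (t / 2)\<^sup>2" by (simp only: abs_le_square_iff)
  moreover have "cos t = 1 - 2 * (sin (t / 2))\<^sup>2"
    using cos_double_sin[of "t / 2"] by simp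
  ultimately show ?thesis by (simp add: power2_eq_square)
qed

lemma integrable_powr_cos:
  assumes "-1 < \<alpha>" shows "(\<lambda>t::real. t powr \<alpha> * cos t) integrable_on {0..b}"
proof (cases "0 \<le> b")
  case True
  have 1: "(\<lambda>t. t powr \<alpha>) integrable_on {0..b}"
    by (rule integrable_on_powr_from_0[OF assms True])
  have "(\<lambda>t. t powr \<alpha>) absolutely_integrable_on {0..b}"
    by (rule nonnegative_absolutely_integrable_1[OF 1]) auto
  then have "(\<lambda>t. cos t * t powr \<alpha>) absolutely_integrable_on {0..b}"
    by (intro absolutely_integrable_bounded_measurable_product_real)
     (auto intro!: continuous_imp_measurable_on_sets_lebesgue continuous_intros
        intro: boundedI[of _ 1])
  then show ?thesis
    by (simp add: mult.commute absolutely_integrable_on_def)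
qed auto

text \<open>
  Write \<open>a = \<pi> / 2\<close>. On the positive lobe \<open>(0, a)\<close>, use \<open>cos t \<ge> 1 - t\<^sup>2 / 2\<close>; on the negative lobe
  \<open>(a, 3 a)\<close>, replace \<open>t powr (-1/2)\<close> by its largest value \<open>a powr (-1/2)\<close>. The sum of the two bounds
  is \<open>a powr (-1/2)\<close> times \<open>2 a - a\<^sup>3 / 5 - 2\<close>, which is about \<open>0.37\<close> and hence safely positive.
\<close>
lemma fresnel_first_lobes_pos:
  "0 < integral {0..3 * pi / 2} (\<lambda>t::real. t powr (-1/2) * cos t)"
proof -
  define a where "a = pi / 2"
  have a: "1.57 < a" "a < 1.58" using pi_approx by (auto simp: a_def)
  let ?q = "\<lambda>t::real. t powr (-1/2) * cos t"
  have q: "?q integrable_on {0..b}" for b by (rule integrable_powr_cos) simp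
  have q': "?q integrable_on {a..3 * a}"
    by (rule integrable_subinterval_real[OF q[of "3 * a"]]) (use a in auto)
  have "((\<lambda>t. t powr (-1/2) - t powr (3/2) / 2) has_integral
        (a powr (-1/2 + 1) / (-1/2 + 1) - a powr (3/2 + 1) / (3/2 + 1) / 2)) {0..a}"
    using a by (intro has_integral_diff has_integral_divide has_integral_powr_from_0) auto
  then have lower: "((\<lambda>t. t powr (-1/2) - t powr (3/2) / 2) has_integral
        (2 * a powr (1/2) - a powr (5/2) / 5)) {0..a}"
    by (simp add: mult.commute)
  have "2 * a powr (1/2) - a powr (5/2) / 5 \<le> integral {0..a} ?q"
  proof (rule has_integral_le[OF lower integrable_integral[OF q]])
    fix t assume t: "t \<in> {0..a}"
    have "t powr (3/2) = t powr (-1/2) * t\<^sup>2"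
    proof (cases "t = 0")
      case False
      then have "t powr (3/2) = t powr (-1/2 + 2)" by simp
      also have "\<dots> = t powr (-1/2) * t powr 2" by (rule powr_add)
      finally show ?thesis using False t by (simp add: powr_numeral)
    qed simp
    then have "t powr (-1/2) - t powr (3/2) / 2 = t powr (-1/2) * (1 - t\<^sup>2 / 2)"
      by (simp add: algebra_simps)
    also have "\<dots> \<le> ?q t" by (intro mult_left_mono cos_bound_below) simp
    finally show "t powr (-1/2) - t powr (3/2) / 2 \<le> ?q t" .
  qed
  moreover have "- 2 * a powr (-1/2) \<le> integral {a..3 * a} ?q"
  proof -
    have "((\<lambda>t. a powr (-1/2) * cos t) has_integral
        (a powr (-1/2) * sin (3 * a) - a powr (-1/2) * sin a)) {a..3 * a}"
      using a by (intro fundamental_theorem_of_calculus)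
        (auto simp flip: has_real_derivative_iff_has_vector_derivative
          intro!: derivative_eq_intros)
    moreover have "sin a = 1" by (simp add: a_def)
    moreover have "sin (3 * a) = -1" using sin_3over2_pi by (simp add: a_def)
    ultimately have "((\<lambda>t. a powr (-1/2) * cos t) has_integral (- 2 * a powr (-1/2))) {a..3 * a}"
      by simp
    then show ?thesis
    proof (rule has_integral_le[OF _ integrable_integral[OF q']])
      fix t assume t: "t \<in> {a..3 * a}"
      have "0 \<le> cos (t - pi)" using t by (intro cos_ge_zero) (auto simp: a_def)
      then have "cos t \<le> 0" by simp
      moreover have "t powr (-1/2) \<le> a powr (-1/2)"
        using t a by (intro powr_mono2') auto
      ultimately show "a powr (-1/2) * cos t \<le> ?q t" by (rule mult_right_mono_neg[rotated])
    qed
  qed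
  moreover have "0 < 2 * a powr (1/2) - a powr (5/2) / 5 - 2 * a powr (-1/2)"
  proof -
    have "a powr (1/2) = a powr (-1/2 + 1)" "a powr (5/2) = a powr (-1/2 + 3)" by simp_all
    then have "a powr (1/2) = a powr (-1/2) * a" "a powr (5/2) = a powr (-1/2) * a ^ 3"
      using a unfolding powr_add by (simp_all add: powr_numeral)
    then have "2 * a powr (1/2) - a powr (5/2) / 5 - 2 * a powr (-1/2)
        = a powr (-1/2) * (2 * a - a ^ 3 / 5 - 2)" by (simp add: algebra_simps)
    moreover have "a ^ 3 \<le> 1.58 ^ 3" using a by (intro power_mono) auto
    ultimately show ?thesis using a by (simp add: power3_eq_cube)
  qed
  moreover have "integral {0..a} ?q + integral {a..3 * a} ?q = integral {0..3 * a} ?q"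
    using a by (intro Henstock_Kurzweil_Integration.integral_combine q) auto
  moreover have "3 * a = 3 * pi / 2" by (simp add: a_def)
  ultimately show ?thesis by simp
qed

section \<open>Strictly convex weights\<close>

text \<open>
  Strict convexity of \<open>f\<close> on \<open>(0, x)\<close> together with \<open>f = 0\<close> beyond \<open>x\<close>, in the form needed after
  folding: \<open>f s - f (s + p)\<close> strictly decreases in \<open>s\<close> as long as \<open>s < x\<close>. Convexity enters through the
  rate of decrease \<open>g\<close>. By the mean value theorem the decrease over \<open>(s, t)\<close> is an increment times a
  value of \<open>g\<close>, and the decrease over the shifted interval uses a later, smaller value of \<open>g\<close> and an
  increment that is no larger. If one of the intervals crosses \<open>x\<close>, it is cut there: \<open>f\<close> vanishes at
  \<open>x\<close> already.
\<close>
lemma truncated_strictly_convex: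
  fixes f g :: "real \<Rightarrow> real"
  assumes zero: "\<And>t. x \<le> t \<Longrightarrow> f t = 0"
    and cont: "continuous_on {0<..x} f"
    and deriv: "\<And>t. 0 < t \<Longrightarrow> t < x \<Longrightarrow> (f has_real_derivative - g t) (at t)"
    and g_pos: "\<And>t. 0 < t \<Longrightarrow> t < x \<Longrightarrow> 0 < g t"
    and g_less: "\<And>s t. 0 < s \<Longrightarrow> s < t \<Longrightarrow> t < x \<Longrightarrow> g t < g s"
    and s: "0 < s" "s < x" and t: "s < t" "t \<le> s + p"
  shows "f (s + p) - f (t + p) < f s - f t"
proof -
  have mvt: "\<exists>z. u < z \<and> z < v \<and> f u - f v = (v - u) * g z"
    if uv: "0 < u" "u < v" "v \<le> x" for u v
  proof -
    have "continuous_on {u..v} f" by (rule continuous_on_subset[OF cont]) (use uv in auto)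
    moreover have "f differentiable (at z)" if "u < z" "z < v" for z
      using deriv[of z] that uv by (auto simp: real_differentiable_def)
    ultimately obtain l z where z: "u < z" "z < v" "(f has_real_derivative l) (at z)"
      "f v - f u = (v - u) * l"
      using MVT[OF uv(2)] by blast
    have "l = - g z" using DERIV_unique[OF z(3) deriv] z uv by simp
    then show ?thesis using z by (intro exI[of _ z]) (simp add: algebra_simps)
  qed
  define t' where "t' = min t x"
  have "f t' = f t" using zero by (auto simp: t'_def min_def)
  moreover have "s < t'" "t' \<le> x" using s t by (auto simp: t'_def)
  ultimately obtain z where z: "s < z" "z < t'" and fz: "f s - f t = (t' - s) * g z"
    using mvt[of s t'] s by auto
  have gz: "0 < g z" using g_pos[of z] z s \<open>t' \<le> x\<close> by simp
  show ?thesis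
  proof (cases "x \<le> s + p")
    case True
    then have "f (s + p) - f (t + p) = 0" using zero t by simp
    then show ?thesis using fz gz z by (simp add: zero_less_mult_iff)
  next
    case False
    define u where "u = min (t + p) x"
    have "f u = f (t + p)" using zero by (auto simp: u_def min_def)
    moreover have "s + p < u" "u \<le> x" "0 < s + p" using s t False by (auto simp: u_def)
    ultimately obtain y where y: "s + p < y" "y < u"
      and fy: "f (s + p) - f (t + p) = (u - (s + p)) * g y"
      using mvt[of "s + p" u] by auto
    have t': "t' = t" using t False by (simp add: t'_def)
    have "g y < g z" using g_less[of z y] y z s t t' \<open>u \<le> x\<close> by simp
    have "(u - (s + p)) * g y < (u - (s + p)) * g z"
      using \<open>g y < g z\<close> \<open>s + p < u\<close> by simp
    also have "\<dots> \<le> (t - s) * g z"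
      using gz by (intro mult_right_mono) (auto simp: u_def)
    finally show ?thesis using fy fz t' by simp
  qed
qed

text \<open>
  After folding, a period starting at \<open>c = 2 \<pi> k\<close> contributes the integral over \<open>(c, c + \<pi>)\<close> of
  \<open>D t cos t\<close> with \<open>D\<close> decreasing. The cosine changes sign once there, from plus to minus, and has
  integral zero, so the contribution is at least \<open>D (c + \<pi> / 2) \<cdot> 0 = 0\<close>. In the first period the
  inequality is strict, since \<open>D\<close> is strictly decreasing near \<open>0\<close>.
\<close>
lemma truncated_convex_cos_integral_pos:
  fixes f g :: "real \<Rightarrow> real"
  assumes x: "0 < x"
    and zero: "\<And>t. x \<le> t \<Longrightarrow> f t = 0"
    and cont: "continuous_on {0<..x} f"
    and deriv: "\<And>t. 0 < t \<Longrightarrow> t < x \<Longrightarrow> (f has_real_derivative - g t) (at t)"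
    and g_pos: "\<And>t. 0 < t \<Longrightarrow> t < x \<Longrightarrow> 0 < g t"
    and g_less: "\<And>s t. 0 < s \<Longrightarrow> s < t \<Longrightarrow> t < x \<Longrightarrow> g t < g s"
    and int: "\<And>a b. (\<lambda>t. f t * cos t) integrable_on {a..b}"
  shows "0 < integral {0..2 * pi + real N * (2 * pi)} (\<lambda>t. f t * cos t)"
proof -
  let ?q = "\<lambda>t. f t * cos t"
  define D where "D t = f t - f (t + pi)" for t
  have D_less: "D t < D s" if "0 < s" "s < x" "s < t" "t \<le> s + pi" for s t
    using truncated_strictly_convex[of x f g s t pi, OF zero cont deriv g_pos g_less] that
    by (simp add: D_def)
  have D_le: "D t \<le> D s" if "0 < s" "s \<le> t" "t \<le> s + pi" for s t
  proof (cases "s < x \<and> s < t")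
    case True
    then show ?thesis using D_less[of s t] that by simp
  next
    case False
    then show ?thesis using that zero by (auto simp: D_def)
  qed
  have cos_shift: "cos (t - real k * (2 * pi)) = cos t" for t and k :: nat
    using cos.minus_of_nat[of t k] by simp
  have cos_nonneg: "0 \<le> cos t"
    if "real k * (2 * pi) < t" "t \<le> real k * (2 * pi) + pi / 2" for t and k :: nat
    using cos_ge_zero[of "t - real k * (2 * pi)"] that pi_gt_zero by (simp add: cos_shift)
  have cos_nonpos: "cos t \<le> 0"
    if "real k * (2 * pi) + pi / 2 < t" "t < real k * (2 * pi) + pi" for t and k :: nat
  proof -
    have "0 \<le> cos (t - real k * (2 * pi) - pi)" using that by (intro cos_ge_zero) auto
    then have "cos (t - real k * (2 * pi)) \<le> 0" by simp
    then show ?thesis by (simp only: cos_shift)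
  qed
  have cos_int: "(cos has_integral 0) {c..c + pi}" if "sin c = 0" for c :: real
  proof -
    have "(cos has_integral (sin (c + pi) - sin c)) {c..c + pi}"
      by (intro fundamental_theorem_of_calculus)
        (auto simp flip: has_real_derivative_iff_has_vector_derivative
          intro!: derivative_eq_intros)
    then show ?thesis using that by simp
  qed
  have sin_k: "sin (real k * (2 * pi)) = 0" for k :: nat
    using sin_npi[of "2 * k"] by (simp add: mult_ac)
  have fold_int: "(\<lambda>t. D t * cos t) integrable_on {c..c + pi}"
    and fold: "integral {c..c + 2 * pi} ?q = integral {c..c + pi} (\<lambda>t. D t * cos t)" for c
    using cos_integral_fold[OF int[of c "c + 2 * pi"]] by (simp_all add: D_def)
  have first: "0 < integral {0..2 * pi} ?q"
  proof -
    have "D (pi / 2) * integral {0..0 + pi} cos < integral {0..0 + pi} (\<lambda>t. D t * cos t)"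
    proof (rule antimono_weight_integral_gt[where d = "min x (pi / 2)"])
      show "D t \<le> D s" if "0 < s" "s \<le> t" "t < 0 + pi" for s t
        using D_le[of s t] that by simp
      show "0 \<le> cos t" if "0 < t" "t \<le> pi / 2" for t :: real
        using cos_nonneg[of 0 t] that by simp
      show "cos t \<le> 0" if "pi / 2 < t" "t < 0 + pi" for t :: real
        using cos_nonpos[of 0 t] that by simp
      show "cos integrable_on {0..0 + pi}"
        using has_integral_integrable[OF cos_int[of 0]] by simp
      show "(\<lambda>t. D t * cos t) integrable_on {0..0 + pi}" by (rule fold_int)
      show "D (pi / 2) < D t \<and> 0 < cos t" if "0 < t" "t < min x (pi / 2)" for t
        using D_less[of t "pi / 2"] cos_gt_zero[of t] that by simp
      show "min x (pi / 2) \<le> 0 + pi" using pi_gt_zero by linarith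
    qed (use x in auto)
    then show ?thesis using fold[of 0] integral_unique[OF cos_int[of 0]] by simp
  qed
  have later: "0 \<le> integral {c..c + 2 * pi} ?q"
    if c: "c = real (Suc k) * (2 * pi)" for c and k :: nat
  proof -
    have "D (c + pi / 2) * integral {c..c + pi} cos \<le> integral {c..c + pi} (\<lambda>t. D t * cos t)"
    proof (rule antimono_weight_integral_ge)
      have "0 < c" by (simp add: c)
      then show "D t \<le> D s" if "c < s" "s \<le> t" "t < c + pi" for s t
        using D_le[of s t] that by simp
      show "0 \<le> cos t" if "c < t" "t \<le> c + pi / 2" for t
        using cos_nonneg[of "Suc k" t] that by (simp only: c)
      show "cos t \<le> 0" if "c + pi / 2 < t" "t < c + pi" for t
        using cos_nonpos[of "Suc k" t] that by (simp only: c)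
      show "cos integrable_on {c..c + pi}"
        using has_integral_integrable[OF cos_int] sin_k[of "Suc k"] by (simp only: c)
      show "(\<lambda>t. D t * cos t) integrable_on {c..c + pi}" by (rule fold_int)
    qed auto
    moreover have "integral {c..c + pi} cos = 0"
      using integral_unique[OF cos_int] sin_k[of "Suc k"] by (simp only: c)
    ultimately show ?thesis by (simp add: fold)
  qed
  have "0 \<le> integral {2 * pi..2 * pi + real N * (2 * pi)} ?q"
    by (rule integral_periods_nonneg[OF _ int later]) (auto simp: algebra_simps)
  then show ?thesis
    using first Henstock_Kurzweil_Integration.integral_combine[OF _ _ int, of 0 "2 * pi"
      "2 * pi + real N * (2 * pi)"] by simp
qed

section \<open>Decreasing multiples of the inverse square root\<close>

text \<open>
  The lobes on \<open>(0, 3 \<pi> / 2)\<close> are treated together: \<open>cos\<close> changes sign once there, so the integral is at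
  least \<open>H (\<pi> / 2)\<close> times the positive constant of \<open>fresnel_first_lobes_pos\<close>. After \<open>3 \<pi> / 2\<close> each
  period begins with a positive lobe, and a decreasing weight gives that lobe the larger share.
\<close>
lemma antimono_fresnel_integral_pos:
  fixes H :: "real \<Rightarrow> real"
  assumes x: "0 < x"
    and H_nonneg: "\<And>t. 0 \<le> H t"
    and H_pos: "\<And>t. 0 < t \<Longrightarrow> t < x \<Longrightarrow> 0 < H t"
    and H_antimono: "\<And>s t. 0 < s \<Longrightarrow> s \<le> t \<Longrightarrow> H t \<le> H s"
    and int: "\<And>a b. (\<lambda>t. H t * (t powr (-1/2) * cos t)) integrable_on {a..b}"
  shows "0 < integral {0..3 * pi / 2 + real N * (2 * pi)} (\<lambda>t. H t * (t powr (-1/2) * cos t))"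
proof -
  let ?v = "\<lambda>t::real. t powr (-1/2) * cos t"
  let ?q = "\<lambda>t. H t * ?v t"
  define f where "f t = H t * t powr (-1/2)" for t
  have f_antimono: "f t \<le> f s" if "0 < s" "s \<le> t" for s t
    unfolding f_def using that H_antimono[of s t] H_nonneg
    by (intro mult_mono powr_mono2') auto
  have q_eq: "?q = (\<lambda>t. f t * cos t)" by (simp add: f_def fun_eq_iff)
  have v_int: "?v integrable_on {0..3 * pi / 2}" by (rule integrable_powr_cos) simp
  have v_nonneg: "0 \<le> ?v t" if "0 < t" "t \<le> pi / 2" for t
    using that by (intro mult_nonneg_nonneg cos_ge_zero) auto
  have v_nonpos: "?v t \<le> 0" if "pi / 2 < t" "t < 3 * pi / 2" for t
  proof -
    have "0 \<le> cos (t - pi)" using that by (intro cos_ge_zero) auto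
    then show ?thesis by (intro mult_nonneg_nonpos) auto
  qed
  have first: "0 < integral {0..3 * pi / 2} ?q"
  proof (cases "H (pi / 2) = 0")
    case True
    \<comment> \<open>The weight has died out before the cosine turns negative, so the constant is lost and strictness
      comes from the integrand on \<open>(0, min x (\<pi> / 2))\<close>.\<close>
    have "H (pi / 2) * integral {0..3 * pi / 2} ?v < integral {0..3 * pi / 2} ?q"
    proof (rule antimono_weight_integral_gt[where d = "min x (pi / 2)"])
      show "H (pi / 2) < H t \<and> 0 < ?v t" if "0 < t" "t < min x (pi / 2)" for t
        using that H_pos[of t] cos_gt_zero[of t] True by simp
      show "min x (pi / 2) \<le> 3 * pi / 2" using pi_gt_zero by linarith
    qed (use x H_antimono v_nonneg v_nonpos v_int int in auto)
    then show ?thesis using True by simp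
  next
    case False
    have "H (pi / 2) * integral {0..3 * pi / 2} ?v \<le> integral {0..3 * pi / 2} ?q"
      by (rule antimono_weight_integral_ge)
        (use H_antimono v_nonneg v_nonpos v_int int in auto)
    moreover have "0 < H (pi / 2) * integral {0..3 * pi / 2} ?v"
      using False H_nonneg[of "pi / 2"] fresnel_first_lobes_pos by simp
    ultimately show ?thesis by linarith
  qed
  have later: "0 \<le> integral {c..c + 2 * pi} ?q"
    if c: "c = 3 * pi / 2 + real k * (2 * pi)" for c and k :: nat
  proof -
    have int': "(\<lambda>t. f t * cos t) integrable_on {c..c + 2 * pi}"
      using int[of c "c + 2 * pi"] by (simp only: q_eq)
    have "0 \<le> integral {c..c + pi} (\<lambda>t. (f t - f (t + pi)) * cos t)"
    proof (rule integral_nonneg_interior[OF cos_integral_fold(1)[OF int']])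
      fix t assume t: "c < t" "t < c + pi"
      have "0 < c" by (simp add: c add_pos_nonneg)
      \<comment> \<open>The lobe starting at \<open>3 \<pi> / 2 + 2 \<pi> k\<close> is centred at \<open>2 \<pi> (k + 1)\<close>.\<close>
      have "0 \<le> cos (t - real (Suc k) * (2 * pi))"
        using t by (intro cos_ge_zero) (auto simp: c algebra_simps)
      also have "cos (t - real (Suc k) * (2 * pi)) = cos t"
        using cos.minus_of_nat[of t "Suc k"] by (simp del: of_nat_Suc)
      finally show "0 \<le> (f t - f (t + pi)) * cos t"
        using f_antimono[of t "t + pi"] t \<open>0 < c\<close> by simp
    qed
    then show ?thesis by (simp only: q_eq cos_integral_fold(2)[OF int'])
  qed
  have "0 \<le> integral {3 * pi / 2..3 * pi / 2 + real N * (2 * pi)} ?q"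
    by (rule integral_periods_nonneg[OF _ int later]) auto
  then show ?thesis
    using first Henstock_Kurzweil_Integration.integral_combine[OF _ _ int, of 0 "3 * pi / 2"
      "3 * pi / 2 + real N * (2 * pi)"] by simp
qed

section \<open>The weight of the theorem, extended by zero\<close>

text \<open>
  Extension by zero lets the upper limit of integration move to the end of a full period of the cosine.
  For \<open>\<alpha> \<le> 0\<close> it also keeps the weight nonincreasing on the whole half-line \<open>t > 0\<close>.
\<close>
definition truncated_weight :: "real \<Rightarrow> real \<Rightarrow> real \<Rightarrow> real \<Rightarrow> real \<Rightarrow> real" where
  "truncated_weight \<mu> lam \<alpha> x t =
    (if 0 < t \<and> t < x then (x powr \<mu> - t powr \<mu>) powr lam * t powr \<alpha> else 0)"

lemma truncated_weight_nonneg: "0 \<le> truncated_weight \<mu> lam \<alpha> x t"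
  by (simp add: truncated_weight_def)

lemma truncated_weight_pos:
  assumes "0 < \<mu>" "0 < t" "t < x" shows "0 < truncated_weight \<mu> lam \<alpha> x t"
  using powr_less_mono2[of \<mu> t x] assms by (simp add: truncated_weight_def)

lemma truncated_weight_antimono:
  assumes "0 < \<mu>" "0 \<le> lam" "\<alpha> \<le> 0" "0 < s" "s \<le> t"
  shows "truncated_weight \<mu> lam \<alpha> x t \<le> truncated_weight \<mu> lam \<alpha> x s"
proof (cases "t < x")
  case True
  have "(x powr \<mu> - t powr \<mu>) powr lam * t powr \<alpha> \<le> (x powr \<mu> - s powr \<mu>) powr lam * s powr \<alpha>"
    using assms True powr_mono2[of \<mu> s t] powr_mono2[of \<mu> t x]
    by (intro mult_mono powr_mono2 powr_mono2') auto
  then show ?thesis using assms True by (simp add: truncated_weight_def)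
next
  case False
  then have "truncated_weight \<mu> lam \<alpha> x t = 0" by (simp add: truncated_weight_def)
  then show ?thesis using truncated_weight_nonneg by simp
qed

lemma truncated_weight_cos_integrable:
  assumes "0 < \<mu>" "0 \<le> lam" "-1 < \<alpha>" "0 < x"
  shows "integrable lborel (\<lambda>t. truncated_weight \<mu> lam \<alpha> x t * cos t)"
proof -
  have meas: "(\<lambda>t. truncated_weight \<mu> lam \<alpha> x t * cos t) \<in> borel_measurable lborel"
    unfolding truncated_weight_def by measurable
  have "(\<lambda>t. t powr \<alpha>) absolutely_integrable_on {0..x}"
    using assms by (intro nonnegative_absolutely_integrable_1 integrable_on_powr_from_0) auto
  then have "integrable lebesgue (\<lambda>t. (x powr \<mu>) powr lam * (indicator {0..x} t *\<^sub>R t powr \<alpha>))"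
    unfolding set_integrable_def by (rule integrable_mult_right)
  then have "integrable lebesgue (\<lambda>t. truncated_weight \<mu> lam \<alpha> x t * cos t)"
  proof (rule Bochner_Integration.integrable_bound)
    show "(\<lambda>t. truncated_weight \<mu> lam \<alpha> x t * cos t) \<in> borel_measurable lebesgue"
      using meas by (rule measurable_completion)
    have "\<bar>truncated_weight \<mu> lam \<alpha> x t * cos t\<bar> \<le> (x powr \<mu>) powr lam * (indicator {0..x} t * t powr \<alpha>)"
      for t
    proof (cases "0 < t \<and> t < x")
      case True
      have "\<bar>truncated_weight \<mu> lam \<alpha> x t * cos t\<bar> \<le> truncated_weight \<mu> lam \<alpha> x t * 1"
        using truncated_weight_nonneg by (simp add: abs_mult mult_left_le)
      also have "\<dots> = (x powr \<mu> - t powr \<mu>) powr lam * t powr \<alpha>"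
        using True by (simp add: truncated_weight_def)
      also have "\<dots> \<le> (x powr \<mu>) powr lam * t powr \<alpha>"
        using assms True powr_mono2[of \<mu> t x] by (intro mult_right_mono powr_mono2) auto
      finally show ?thesis using True by simp
    qed (auto simp: truncated_weight_def)
    then show "AE t in lebesgue. norm (truncated_weight \<mu> lam \<alpha> x t * cos t)
        \<le> norm ((x powr \<mu>) powr lam * (indicator {0..x} t *\<^sub>R t powr \<alpha>))"
      by (intro AE_I2) (simp add: abs_mult)
  qed
  then show ?thesis using meas by (simp add: integrable_completion)
qed

lemma truncated_weight_cos_integral:
  assumes "0 < \<mu>" "0 \<le> lam" "-1 < \<alpha>" "0 < x"
  shows "(\<lambda>t. truncated_weight \<mu> lam \<alpha> x t * cos t) integrable_on {a..b}"
    and "x \<le> c \<Longrightarrow> (LBINT t=0..x. (x powr \<mu> - t powr \<mu>) powr lam * t powr \<alpha> * cos t)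
      = integral {0..c} (\<lambda>t. truncated_weight \<mu> lam \<alpha> x t * cos t)"
proof -
  let ?q = "\<lambda>t. truncated_weight \<mu> lam \<alpha> x t * cos t"
  note int = truncated_weight_cos_integrable[OF assms]
  show "?q integrable_on {a..b}"
    by (rule integrable_on_subinterval[OF integrable_on_lborel[OF int]]) simp
  assume c: "x \<le> c"
  have "(LBINT t=0..x. (x powr \<mu> - t powr \<mu>) powr lam * t powr \<alpha> * cos t) = (LINT t|lborel. ?q t)"
    unfolding interval_lebesgue_integral_def set_lebesgue_integral_def
    using \<open>0 < x\<close>
    by (auto intro!: Bochner_Integration.integral_cong simp: truncated_weight_def einterval_def indicator_def
        zero_ereal_def)
  also have "\<dots> = integral UNIV ?q" by (rule integral_lborel[OF int, symmetric])
  also have "\<dots> = integral UNIV (\<lambda>t. if t \<in> {0..c} then ?q t else 0)"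
    using c by (intro arg_cong[where f = "integral UNIV"]) (auto simp: truncated_weight_def fun_eq_iff)
  also have "\<dots> = integral {0..c} ?q" by (rule integral_restrict_UNIV)
  finally show "(LBINT t=0..x. (x powr \<mu> - t powr \<mu>) powr lam * t powr \<alpha> * cos t)
      = integral {0..c} ?q" .
qed

lemma ex_period_bound: "\<exists>N::nat. x \<le> c + real N * (2 * pi)"
proof -
  obtain N :: nat where "x - c < real N * (2 * pi)"
    using reals_Archimedean3[of "2 * pi"] pi_gt_zero by fastforce
  then show ?thesis by (intro exI[of _ N]) simp
qed

section \<open>The two parameter ranges\<close>

text \<open>
  Splitting off \<open>t powr (-1/2)\<close> leaves the same weight with exponent \<open>\<alpha> + 1/2 \<le> 0\<close>, which is still
  decreasing.
\<close>
lemma truncated_weight_cos_integral_pos_singular: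
  assumes "0 < \<mu>" "0 \<le> lam" "-1 < \<alpha>" "\<alpha> \<le> -1/2" "0 < x"
  shows "(LBINT t=0..x. (x powr \<mu> - t powr \<mu>) powr lam * t powr \<alpha> * cos t) > 0"
proof -
  let ?H = "truncated_weight \<mu> lam (\<alpha> + 1/2) x"
  obtain N :: nat where N: "x \<le> 3 * pi / 2 + real N * (2 * pi)" using ex_period_bound by blast
  have eq: "truncated_weight \<mu> lam \<alpha> x t * cos t = ?H t * (t powr (-1/2) * cos t)" for t
  proof -
    have "t powr \<alpha> = t powr (\<alpha> + 1/2) * t powr (-1/2)" by (simp flip: powr_add)
    then show ?thesis by (simp add: truncated_weight_def)
  qed
  have "0 < integral {0..3 * pi / 2 + real N * (2 * pi)} (\<lambda>t. ?H t * (t powr (-1/2) * cos t))"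
  proof (rule antimono_fresnel_integral_pos)
    show "(\<lambda>t. ?H t * (t powr (-1/2) * cos t)) integrable_on {a..b}" for a b
      using truncated_weight_cos_integral(1)[of \<mu> lam \<alpha> x a b] assms by (simp only: eq)
    show "0 < ?H t" if "0 < t" "t < x" for t
      using truncated_weight_pos that assms by blast
    show "?H t \<le> ?H s" if "0 < s" "s \<le> t" for s t
      using that assms by (intro truncated_weight_antimono) auto
  qed (use assms truncated_weight_nonneg in auto)
  then show ?thesis using truncated_weight_cos_integral(2)[OF _ _ _ _ N] assms by (simp add: eq)
qed

text \<open>
  The rate of decrease of the weight on \<open>(0, x)\<close> is
  
  \<open>g t = lam \<mu> t powr (\<mu> - 1 + \<alpha>) (x powr \<mu> - t powr \<mu>) powr (lam - 1)
    - \<alpha> t powr (\<alpha> - 1) (x powr \<mu> - t powr \<mu>) powr lam\<close>,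
  
  and under the sign conditions on the exponents each factor is positive and nonincreasing. The first
  summand decreases strictly unless \<open>\<mu> + \<alpha> = 1\<close> and \<open>lam = 1\<close>, i.e. unless the weight is the affine
  function \<open>x - t\<close>.
\<close>
lemma truncated_weight_cos_integral_pos_convex:
  assumes \<mu>: "0 < \<mu>" "\<mu> \<le> 1" and lam: "1 \<le> lam" and \<alpha>: "-1 < \<alpha>" "\<alpha> \<le> 0" and x: "0 < x"
    and nondeg: "\<mu> + \<alpha> < 1 \<or> 1 < lam"
  shows "(LBINT t=0..x. (x powr \<mu> - t powr \<mu>) powr lam * t powr \<alpha> * cos t) > 0"
proof -
  let ?K = "truncated_weight \<mu> lam \<alpha> x"
  let ?d = "\<lambda>t. x powr \<mu> - t powr \<mu>"
  define g where "g t = lam * \<mu> * (t powr (\<mu> - 1 + \<alpha>) * ?d t powr (lam - 1))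
      + (- \<alpha>) * (t powr (\<alpha> - 1) * ?d t powr lam)" for t
  have d_pos: "0 < ?d t" if "0 < t" "t < x" for t
    using powr_less_mono2[of \<mu> t x] that \<mu> by simp
  have d_less: "?d t < ?d s" if "0 < s" "s < t" for s t
    using powr_less_mono2[of \<mu> s t] that \<mu> by simp
  have deriv: "(?K has_real_derivative - g t) (at t)" if t: "0 < t" "t < x" for t
  proof -
    have "((\<lambda>t. ?d t powr lam * t powr \<alpha>) has_real_derivative - g t) (at t)"
      using t d_pos[OF t] unfolding g_def
      by (auto intro!: derivative_eq_intros simp: algebra_simps powr_add powr_diff)
    moreover have "eventually (\<lambda>u. u \<in> {0<..<x}) (nhds t)"
      using t by (intro eventually_nhds_in_open) auto
    then have "eventually (\<lambda>u. ?d u powr lam * u powr \<alpha> = ?K u) (nhds t)"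
      by eventually_elim (simp add: truncated_weight_def)
    ultimately show ?thesis by (simp add: DERIV_cong_ev[OF refl _ refl])
  qed
  have cont: "continuous_on {0<..x} ?K"
  proof -
    have "continuous_on {0<..x} (\<lambda>t. ?d t powr lam * t powr \<alpha>)"
      using lam by (intro continuous_intros continuous_on_powr')
        (auto intro: powr_mono2 simp: \<mu> less_imp_le)
    then show ?thesis
      by (rule continuous_on_eq) (auto simp: truncated_weight_def)
  qed
  have first_pos: "0 < lam * \<mu> * (t powr (\<mu> - 1 + \<alpha>) * ?d t powr (lam - 1))"
    if "0 < t" "t < x" for t
    using that d_pos[OF that] \<mu> lam by simp
  have g_pos: "0 < g t" if "0 < t" "t < x" for t
    unfolding g_def using first_pos[OF that] \<alpha> by (intro add_pos_nonneg mult_nonneg_nonneg) auto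
  have g_less: "g t < g s" if st: "0 < s" "s < t" "t < x" for s t
  proof -
    have d: "0 < ?d t" "?d t < ?d s" using d_pos[of t] d_less[of s t] st by auto
    have "t powr (\<mu> - 1 + \<alpha>) * ?d t powr (lam - 1) < s powr (\<mu> - 1 + \<alpha>) * ?d s powr (lam - 1)"
    proof (cases "\<mu> + \<alpha> < 1")
      case True
      have "t powr (\<mu> - 1 + \<alpha>) < s powr (\<mu> - 1 + \<alpha>)"
        using st True by (intro powr_less_mono2_neg) auto
      moreover have "?d t powr (lam - 1) \<le> ?d s powr (lam - 1)"
        using d lam by (intro powr_mono2) auto
      ultimately show ?thesis using d by (intro mult_less_le_imp_less) auto
    next
      case False
      have "t powr (\<mu> - 1 + \<alpha>) \<le> s powr (\<mu> - 1 + \<alpha>)"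
        using st \<mu> \<alpha> by (intro powr_mono2') auto
      moreover have "?d t powr (lam - 1) < ?d s powr (lam - 1)"
        using d nondeg False by (intro powr_less_mono2) auto
      ultimately show ?thesis using st by (intro mult_le_less_imp_less) auto
    qed
    moreover have "t powr (\<alpha> - 1) * ?d t powr lam \<le> s powr (\<alpha> - 1) * ?d s powr lam"
      using st d \<alpha> lam by (intro mult_mono powr_mono2 powr_mono2') auto
    ultimately show ?thesis
      unfolding g_def using \<mu> lam \<alpha> by (intro add_less_le_mono mult_strict_left_mono mult_left_mono) auto
  qed
  obtain N :: nat where N: "x \<le> 2 * pi + real N * (2 * pi)" using ex_period_bound by blast
  have "0 < integral {0..2 * pi + real N * (2 * pi)} (\<lambda>t. ?K t * cos t)"
    by (rule truncated_convex_cos_integral_pos[OF x _ cont deriv g_pos g_less])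
      (use assms truncated_weight_cos_integral(1) in \<open>auto simp: truncated_weight_def\<close>)
  then show ?thesis using truncated_weight_cos_integral(2)[OF _ _ _ _ N] assms by simp
qed

theorem corollary4p1:
  fixes \<mu> lam \<alpha> x :: real
  assumes params: "(\<mu> > 0 \<and> lam \<ge> 0 \<and> -1 < \<alpha> \<and> \<alpha> \<le> -1/2)
                 \<or> (0 < \<mu> \<and> \<mu> \<le> 1 \<and> 1 \<le> lam \<and> -1 < \<alpha> \<and> \<alpha> \<le> 0)"
    and x: "x > 0"
    and non_degenerate: "\<not> (\<mu> = 1 \<and> lam = 1 \<and> \<alpha> = 0 \<and> (\<exists>k::nat. x = 2 * pi * real k))"
  shows "(LBINT t=0..x. (x powr \<mu> - t powr \<mu>) powr lam * t powr \<alpha> * cos t) > 0"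
  using params
proof
  assume "\<mu> > 0 \<and> lam \<ge> 0 \<and> -1 < \<alpha> \<and> \<alpha> \<le> -1/2"
  then show ?thesis using x by (intro truncated_weight_cos_integral_pos_singular) auto
next
  assume b: "0 < \<mu> \<and> \<mu> \<le> 1 \<and> 1 \<le> lam \<and> -1 < \<alpha> \<and> \<alpha> \<le> 0"
  show ?thesis
  proof (cases "\<mu> + \<alpha> < 1 \<or> 1 < lam")
    case True
    then show ?thesis using b x by (intro truncated_weight_cos_integral_pos_convex) auto
  next
    case False
    \<comment> \<open>The affine weight: the integral is \<open>1 - cos x\<close>, and only its zeros have to be excluded.\<close>
    then have eq: "\<mu> = 1" "lam = 1" "\<alpha> = 0" using b by auto
    then have "(LBINT t=0..x. (x powr \<mu> - t powr \<mu>) powr lam * t powr \<alpha> * cos t) \<noteq> 0"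
      using corner_integral_eq_0_iff[OF x] non_degenerate by simp
    moreover have "0 \<le> 1 - cos x" by simp
    ultimately show ?thesis using corner_integral[OF x] unfolding eq by linarith
  qed
qed

end
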